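(* For every $n \in \mathbb{N}$, the equation $\varphi(x) = n$ admits a finite number of solutions $x$.
   Context: $\varphi$ denotes Euler's totient function, $\mathbb{N} = \{0, 1, 2, \dots\}$, and the unknown $x$ ranges over $\mathbb{N}$, with the convention $\varphi(0) = \varphi(3) = 2$. *)

theory Defs
  imports "HOL-Number_Theory.Totient"
begin

text \<open>The library has \<^term>\<open>totient 0 = 0\<close>; here the convention is that the value at 0 equals
  the value at 3, namely 2 (the number of units of \<open>\<int>/0\<int> = \<int>\<close>).\<close>

definition phi :: "nat \<Rightarrow> nat" where
  "phi x = (if x = 0 then 2 else totient x)"

end

theory Submission
  imports Defs
begin

text \<open>Every prime factor \<open>p\<close> of \<open>x\<close> satisfies \<open>p - 1 \<le> \<phi>(x)\<close>. Hence \<open>\<phi>(x) / x\<close>, the product of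
  \<open>1 - 1/p\<close> over these primes, is at least the telescoping product of \<open>1 - 1/k\<close> over
  \<open>2 \<le> k \<le> \<phi>(x) + 1\<close>, which is \<open>1 / (\<phi>(x) + 1)\<close>. So \<open>x \<le> \<phi>(x) (\<phi>(x) + 1)\<close>.\<close>

text \<open>For positive \<open>x\<close>, \<open>totient\<close> is monotone along divisibility,
  and \<open>totient p = p - 1\<close>.\<close>

lemma prime_factor_le_Suc_totient:
  fixes p x :: nat
  assumes "p \<in> prime_factors x"
  shows "p \<le> Suc (totient x)"
proof -
  have "prime p" "p dvd x" "x > 0"
    using assms by (auto simp: prime_factors_dvd intro: Nat.gr0I)
  then have "p - 1 \<le> totient x"
    using totient_dvd_mono[of p x] by (simp add: totient_prime)
  then show ?thesis by simp
qed

lemma prod_one_minus_inverse: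
  "(\<Prod>k=2..Suc n. 1 - 1 / real k) = 1 / real (Suc n)"
  by (induction n) (simp_all add: prod.nat_ivl_Suc' field_simps)

lemma le_totient_mult_Suc_totient:
  "x \<le> totient x * Suc (totient x)"
proof (cases "x = 0")
  case False
  define n where "n = totient x"
  let ?f = "\<lambda>k::nat. 1 - 1 / real k" and ?P = "prime_factors x"
  have sub: "?P \<subseteq> {2..Suc n}"
    using prime_factor_le_Suc_totient prime_ge_2_nat[OF in_prime_factors_imp_prime]
    by (auto simp: n_def)
  have "1 / real (Suc n) = prod ?f {2..Suc n}"
    by (rule prod_one_minus_inverse[symmetric])
  also have "\<dots> = prod ?f ({2..Suc n} - ?P) * prod ?f ?P"
    using sub by (intro prod.subset_diff) auto
  \<comment> \<open>The factors at non-primes or primes not dividing \<open>x\<close> all lie in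
    [0, 1], so dropping them cannot decrease the product.\<close>
  also have "\<dots> \<le> 1 * prod ?f ?P"
    using sub by (intro mult_right_mono prod_le_1 prod_nonneg) auto
  finally have "real x * (1 / real (Suc n)) \<le> real x * prod ?f ?P"
    by (intro mult_left_mono) auto
  \<comment> \<open>Euler's product formula for the totient.\<close>
  also have "\<dots> = real n"
    unfolding n_def by (rule totient_formula2[symmetric])
  finally have "real x \<le> real (n * Suc n)"
    by (simp add: field_simps)
  then show ?thesis
    unfolding n_def of_nat_le_iff .
qed simp

theorem lemma1:
  fixes n :: nat
  shows "finite {x::nat. phi x = n}"
proof (rule finite_subset)
  show "{x. phi x = n} \<subseteq> {..n * Suc n}"
  proof
    fix x assume "x \<in> {x. phi x = n}"
    \<comment> \<open>The convention at 0 is harmless: 0 lies below every bound, and elsewhere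
      \<open>phi\<close> is \<open>totient\<close>.\<close>
    then show "x \<in> {..n * Suc n}"
      using le_totient_mult_Suc_totient[of x] by (cases "x = 0") (auto simp: phi_def)
  qed
qed simp

end
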